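(* Let $B$ be the $N\times N$ real upper bidiagonal matrix with diagonal entries $B_{i,i}=\sqrt{q_i}$ ($i=1,\dots,N$), upper subdiagonal entries $B_{i,i+1}=\sqrt{e_i}$ ($i=1,\dots,N-1$), and all other entries zero, where $q_i>0$ for $i=1,\dots,N$ and $e_i>0$ for $i=1,\dots,N-1$. Define $$\tilde F_i=\frac{e_{i-1}}{q_i},\qquad i=2,\dots,N.$$ Let the constants $h_i^{(p)}$ ($i=1,\dots,N$, $p=1,2,\dots$) be given by the following recurrence relation. For $p=1$, $$h_1^{(1)}=\frac1{q_1},\qquad h_i^{(1)}=\tilde F_i\,h_{i-1}^{(1)}+\frac1{q_i},\quad i=2,\dots,N.$$ For $i=1$ and $p=2,3,\dots$, $$h_1^{(p)}=0.$$ For $i=2,\dots,N$ and $p=2,3,\dots$, $$h_i^{(p)}=\tilde F_i\left(h_{i-1}^{(p)}+p\,h_{i-1}^{(1)}h_{i-1}^{(p-1)}\right)+\sum_{k=1}^{p-2}\binom{p}{k}h_{i-1}^{(k)}h_i^{(p-k)}.$$ Let the constants $H_i^{(p)}$ ($i=1,\dots,N$, $p=1,2,\dots$) be given by $$H_i^{(1)}=h_i^{(1)},\qquad H_i^{(p)}=h_i^{(p)}+\sum_{k=1}^{p-1}\binom{p-1}{k}h_i^{(k)}H_i^{(p-k)},\quad p=2,3,\dots.$$ Then for every $p=1,2,\dots$, $$\mathrm{Tr}\left((B^{\top}B)^{-p}\right)=\frac1{(p-1)!}\sum_{i=1}^{N}H_i^{(p)}.$$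
   Context: Convention: $\sum_{i=j}^{k}=0$ if $j>k$. $\mathrm{Tr}$ denotes the trace, $B^\top$ the transpose, and $(B^\top B)^{-p}$ the $p$-th power of the inverse of $B^\top B$. *)

theory Defs
  imports Complex_Main "Jordan_Normal_Form.Determinant"
begin

text \<open>Matrix entries are indexed from 0, while the sequences \<open>q\<close> and \<open>e\<close> keep their
  indexing from 1; hence the shift by one.\<close>

definition bidiag_mat :: "nat \<Rightarrow> (nat \<Rightarrow> real) \<Rightarrow> (nat \<Rightarrow> real) \<Rightarrow> real mat" where
  "bidiag_mat N q e = mat N N (\<lambda>(i, j).
     if j = i then sqrt (q (i + 1))
     else if j = i + 1 then sqrt (e (i + 1))
     else 0)"

definition mat_trace :: "'a :: comm_monoid_add mat \<Rightarrow> 'a" where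
  "mat_trace A = (\<Sum>i<dim_row A. A $$ (i, i))"

text \<open>The power \<open>A\<^sup>-\<^sup>p = (A\<^sup>-\<^sup>1)\<^sup>p\<close>. It is meaningful for invertible \<open>A\<close> only, because
  \<open>mat_inverse A\<close> is \<open>None\<close> for singular \<open>A\<close>.\<close>

definition mat_neg_power :: "'a :: field mat \<Rightarrow> nat \<Rightarrow> 'a mat" where
  "mat_neg_power A p = the (mat_inverse A) ^\<^sub>m p"

text \<open>For positive \<open>q\<^sub>i\<close>, the inverse below is a genuine one.\<close>

lemma bidiag_gram_inverse:
  fixes N :: nat and q e :: "nat \<Rightarrow> real"
  assumes "\<And>i. i \<in> {1..N} \<Longrightarrow> q i > 0"
  defines "A \<equiv> transpose_mat (bidiag_mat N q e) * bidiag_mat N q e"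
  obtains C where "mat_inverse A = Some C" "C \<in> carrier_mat N N"
    "A * C = 1\<^sub>m N" "C * A = 1\<^sub>m N"
proof -
  let ?B = "bidiag_mat N q e"
  have B: "?B \<in> carrier_mat N N" by (simp add: bidiag_mat_def)
  have A: "A \<in> carrier_mat N N" unfolding A_def using B by auto
  have "upper_triangular ?B" by (auto simp: bidiag_mat_def)
  hence "det ?B = prod_list (diag_mat ?B)" using B by (rule det_upper_triangular)
  moreover have "x \<noteq> 0" if "x \<in> set (diag_mat ?B)" for x
  proof -
    from that obtain i where "i < N" "x = sqrt (q (i + 1))"
      by (auto simp: diag_mat_def bidiag_mat_def)
    with assms(1)[of "i + 1"] show ?thesis by auto
  qed
  ultimately have "det ?B \<noteq> 0" by (auto simp: prod_list_zero_iff)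
  hence "det A \<noteq> 0"
    unfolding A_def using B det_mult[of "transpose_mat ?B" N ?B] det_transpose[OF B] by simp
  hence "A \<in> Units (ring_mat TYPE(real) N ())" by (rule det_non_zero_imp_unit[OF A])
  then obtain C where C: "mat_inverse A = Some C"
    using mat_inverse(1)[OF A, of "()"] by (cases "mat_inverse A") auto
  with mat_inverse(2)[OF A C] show ?thesis using that by blast
qed

end

theory Submission
  imports Defs "HOL-Computational_Algebra.Formal_Power_Series"
begin

text \<open>
  Work with formal power series in \<open>x\<close>. For \<open>A = B\<^sup>T B\<close> the resolvent \<open>(A - x)\<^sup>-\<^sup>1\<close> is the
  generating function of the powers \<open>(A\<^sup>-\<^sup>1)\<^sup>p\<^sup>+\<^sup>1\<close>, and \<open>A - x\<close> is tridiagonal. If \<open>d\<^sub>i\<close> are its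
  elimination pivots, the trace of the resolvent is the sum of the \<open>- d\<^sub>i' / d\<^sub>i\<close>. With \<open>g\<^sub>i\<close> the
  exponential generating function of the \<open>h\<^sub>i\<close>, the recurrence for \<open>h\<close> is the pivot recurrence
  for \<open>d\<^sub>i = q\<^sub>i (1 - g\<^sub>i)\<close>, and the recurrence for \<open>H\<close> says that the (shifted) exponential
  generating function of the \<open>H\<^sub>i\<close> is \<open>g\<^sub>i' / (1 - g\<^sub>i) = - d\<^sub>i' / d\<^sub>i\<close>.
\<close>

section \<open>Powers and inverses of symmetric matrices\<close>

lemma pow_mat_Suc_left:
  assumes "A \<in> carrier_mat n n"
  shows "A * A ^\<^sub>m p = A ^\<^sub>m Suc p"
proof (induction p)
  case 0
  with assms show ?case by simp
next
  case (Suc p)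
  have "A * A ^\<^sub>m Suc p = (A * A ^\<^sub>m p) * A"
    using assms by (simp add: assoc_mult_mat[of A n n _ n _ n] pow_carrier_mat)
  with Suc show ?case by simp
qed

lemma transpose_pow_mat:
  fixes A :: "'a :: comm_semiring_1 mat"
  assumes "A \<in> carrier_mat n n"
  shows "transpose_mat (A ^\<^sub>m p) = transpose_mat A ^\<^sub>m p"
proof (induction p)
  case 0
  with assms show ?case by simp
next
  case (Suc p)
  have "transpose_mat (A ^\<^sub>m Suc p) = transpose_mat A * transpose_mat (A ^\<^sub>m p)"
    using assms by (simp add: transpose_mult[of _ n n _ n] pow_carrier_mat)
  also have "\<dots> = transpose_mat A ^\<^sub>m Suc p"
    unfolding Suc by (rule pow_mat_Suc_left[of _ n]) (use assms in simp)
  finally show ?case .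
qed

text \<open>Transposing \<open>A * C = 1\<^sub>m n\<close> shows that the transpose of
  \<open>C\<close> is a left inverse of \<open>A\<close>; a left and a right inverse
  coincide.\<close>

lemma transpose_inverse_symmetric:
  fixes A :: "'a :: comm_semiring_1 mat"
  assumes A: "A \<in> carrier_mat n n" "transpose_mat A = A"
    and C: "C \<in> carrier_mat n n" "A * C = 1\<^sub>m n"
  shows "transpose_mat C = C"
proof -
  have "transpose_mat C * A = 1\<^sub>m n"
    using transpose_mult[OF A(1) C(1)] A(2) C(2) by simp
  then have "C = (transpose_mat C * A) * C" using C by simp
  also have "\<dots> = transpose_mat C"
    using A C by (simp add: assoc_mult_mat[of _ n n _ n _ n])
  finally show ?thesis by simp
qed

section \<open>Resolvents of tridiagonal matrices\<close>

lemma sum_tridiagonal: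
  fixes f :: "nat \<Rightarrow> 'a :: comm_monoid_add"
  assumes "i < n" "f n = 0" "\<And>k. k < n \<Longrightarrow> k > Suc i \<or> i > Suc k \<Longrightarrow> f k = 0"
  shows "sum f {..<n} = (if i = 0 then 0 else f (i - 1)) + (f i + f (Suc i))"
proof -
  have z: "f k = 0" if "k \<le> n" "k > Suc i \<or> i > Suc k" for k
    using assms that by (cases "k = n") auto
  have "sum f {..<n} = sum f {..n}"
    using assms(2) by (simp add: lessThan_Suc_atMost[symmetric])
  also have "\<dots> = sum f {i - 1..Suc i}"
    using assms(1) by (intro sum.mono_neutral_right) (auto intro!: z)
  \<comment> \<open>For \<open>i = 0\<close>, truncated subtraction gives \<open>i - 1 = i\<close>;
    the first piece is then empty, so that the union stays disjoint.\<close>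
  also have "{i - 1..Suc i} = (if i = 0 then {} else {i - 1}) \<union> {i, Suc i}" by auto
  finally show ?thesis by (auto simp: ac_simps)
qed

text \<open>
  With \<open>C = A\<^sup>-\<^sup>1\<close> this is the \<open>(i, j)\<close> entry of \<open>(A - x)\<^sup>-\<^sup>1\<close>. The value 0 out of range lets the
  three-term recurrences hold in the last row as well.
\<close>

definition resolvent_fps :: "'a :: comm_ring_1 mat \<Rightarrow> nat \<Rightarrow> nat \<Rightarrow> 'a fps" where
  "resolvent_fps C i j =
     (if i < dim_row C \<and> j < dim_row C then Abs_fps (\<lambda>p. (C ^\<^sub>m Suc p) $$ (i, j)) else 0)"

text \<open>This is \<open>(A - x) R = 1\<close> read entrywise. The coefficient of
  \<open>x^p\<close> says that \<open>A\<close> times the power \<open>p + 1\<close> of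
  \<open>C\<close> is the power \<open>p\<close>; the case \<open>p = 0\<close> supplies the
  identity matrix.\<close>

lemma resolvent_fps_row:
  fixes A C :: "'a :: comm_ring_1 mat"
  assumes A: "A \<in> carrier_mat n n" and C: "C \<in> carrier_mat n n" and AC: "A * C = 1\<^sub>m n"
    and ij: "i < n" "j < n"
  shows "(\<Sum>k<n. fps_const (A $$ (i, k)) * resolvent_fps C k j)
           = (if i = j then 1 else 0) + fps_X * resolvent_fps C i j"
proof (rule fps_ext)
  fix p
  have Cp: "C ^\<^sub>m p \<in> carrier_mat n n" "C ^\<^sub>m Suc p \<in> carrier_mat n n" using C by auto
  have "fps_nth (\<Sum>k<n. fps_const (A $$ (i, k)) * resolvent_fps C k j) p
      = (\<Sum>k<n. A $$ (i, k) * (C ^\<^sub>m Suc p) $$ (k, j))"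
    using C ij by (simp add: fps_sum_nth resolvent_fps_def)
  also have "\<dots> = (A * C ^\<^sub>m Suc p) $$ (i, j)"
    using A carrier_matD[OF Cp(2)] ij
    by (simp add: scalar_prod_def lessThan_atLeast0 del: pow_mat.simps pow_mat_dim)
  also have "A * C ^\<^sub>m Suc p = (A * C) * C ^\<^sub>m p"
    unfolding pow_mat_Suc_left[OF C, symmetric] by (rule assoc_mult_mat[symmetric]) (fact A C Cp)+
  also have "\<dots> = C ^\<^sub>m p" using AC left_mult_one_mat[OF Cp(1)] by simp
  finally show "fps_nth (\<Sum>k<n. fps_const (A $$ (i, k)) * resolvent_fps C k j) p
      = fps_nth ((if i = j then 1 else 0) + fps_X * resolvent_fps C i j) p"
    using C ij by (cases p) (auto simp: resolvent_fps_def)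
qed

lemma resolvent_fps_sym:
  fixes C :: "'a :: comm_ring_1 mat"
  assumes "C \<in> carrier_mat n n" "transpose_mat C = C"
  shows "resolvent_fps C i j = resolvent_fps C j i"
proof -
  have "(C ^\<^sub>m Suc p) $$ (i, j) = (C ^\<^sub>m Suc p) $$ (j, i)" if "i < n" "j < n" for p
  proof -
    have "transpose_mat (C ^\<^sub>m Suc p) $$ (i, j) = (C ^\<^sub>m Suc p) $$ (j, i)"
      by (rule index_transpose_mat(1)) (use that assms in auto)
    then show ?thesis using transpose_pow_mat[OF assms(1), of "Suc p"] assms(2) by simp
  qed
  with assms(1) show ?thesis by (auto simp: resolvent_fps_def)
qed

text \<open>
  Elimination gives \<open>R\<^sub>i\<^sub>i = 1 / D\<^sub>i + c\<^sub>i R\<^sub>i\<^sub>+\<^sub>1\<^sub>,\<^sub>i\<^sub>+\<^sub>1\<close>, and differentiating the pivot recurrence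
  gives the adjoint relation \<open>u\<^sub>i\<^sub>+\<^sub>1 = 1 + c\<^sub>i u\<^sub>i\<close> for \<open>u\<^sub>i = - D\<^sub>i'\<close>; summation by parts combines them.
\<close>

lemma trace_resolvent_tridiagonal:
  fixes A C :: "'a :: field mat" and D :: "nat \<Rightarrow> 'a fps"
  assumes A: "A \<in> carrier_mat n n" and C: "C \<in> carrier_mat n n" and AC: "A * C = 1\<^sub>m n"
    and sym: "transpose_mat A = A"
    and tri: "\<And>i j. i < n \<Longrightarrow> j < n \<Longrightarrow> j > Suc i \<or> i > Suc j \<Longrightarrow> A $$ (i, j) = 0"
    and D0: "D 0 = fps_const (A $$ (0, 0)) - fps_X"
    and DSuc: "\<And>i. Suc i < n \<Longrightarrow> D (Suc i) = fps_const (A $$ (Suc i, Suc i)) - fps_X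
                 - fps_const (A $$ (i, Suc i) ^ 2) * inverse (D i)"
    and Dnz: "\<And>i. i < n \<Longrightarrow> fps_nth (D i) 0 \<noteq> 0"
  shows "(\<Sum>i<n. resolvent_fps C i i) = (\<Sum>i<n. - fps_deriv (D i) * inverse (D i))"
proof -
  define R where "R = resolvent_fps C"
  define m where "m i = fps_const (A $$ (i, Suc i))" for i
  define V where "V i = inverse (D i)" for i
  have DV: "D i * V i = 1" if "i < n" for i
    using inverse_mult_eq_1'[OF Dnz[OF that]] by (simp add: V_def)
  have R_out: "R i j = 0" if "i \<ge> n" for i j
    using that C by (simp add: R_def resolvent_fps_def)
  have R_sym: "R i j = R j i" for i j
    unfolding R_def by (rule resolvent_fps_sym[OF C transpose_inverse_symmetric[OF A sym C AC]])
  have row: "(if i = 0 then 0 else m (i - 1) * R (i - 1) j) + (fps_const (A $$ (i, i)) * R i j + m i * R (Suc i) j)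
      = (if i = j then 1 else 0) + fps_X * R i j" if ij: "i < n" "j < n" for i j
  proof -
    have "A $$ (i, i - 1) = A $$ (i - 1, i)"
      using index_transpose_mat(1)[of i A "i - 1"] A sym ij by simp
    with sum_tridiagonal[of i n "\<lambda>k. fps_const (A $$ (i, k)) * R k j"]
      resolvent_fps_row[OF A C AC ij] ij tri R_out
    show ?thesis by (auto simp: R_def[symmetric] m_def)
  qed
  \<comment> \<open>Forward elimination on column \<open>j\<close>. Up to row \<open>j\<close> it
    only subtracts multiples of rows with right-hand side 0, so the unit vector on the right is
    unchanged; hence the restriction to \<open>i \<le> j\<close>.\<close>
  have elim: "D i * R i j + m i * R (Suc i) j = (if i = j then 1 else 0)"
    if "i \<le> j" "j < n" for i j
    using that
  proof (induction i)
    case 0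
    with row[of 0 j] show ?case by (simp add: D0 algebra_simps)
  next
    case (Suc i)
    then have IH: "D i * R i j + m i * R (Suc i) j = 0" and "i < n" by auto
    have "R i j = V i * (D i * R i j)" using DV[OF \<open>i < n\<close>] by (simp add: algebra_simps)
    also have "D i * R i j = - m i * R (Suc i) j" using IH by (simp add: eq_neg_iff_add_eq_0)
    finally have "m i * R i j = - (m i ^ 2 * V i * R (Suc i) j)"
      by (simp add: power2_eq_square)
    moreover have "fps_const ((A $$ (i, Suc i))\<^sup>2) = m i ^ 2"
      by (simp add: m_def power2_eq_square)
    ultimately have "D (Suc i) = fps_const (A $$ (Suc i, Suc i)) - fps_X - m i ^ 2 * V i"
      and "m i * R i j = - (m i ^ 2 * V i * R (Suc i) j)"
      using Suc.prems by (simp_all add: DSuc V_def)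
    note D_Suc = this(1) and mR = this(2)
    show ?case unfolding D_Suc using row[of "Suc i" j] Suc.prems mR by (simp add: algebra_simps)
  qed
  define c where "c i = (m i * V i) ^ 2" for i
  have R_diag: "R i i = V i + c i * R (Suc i) (Suc i)" if "i < n" for i
  proof -
    have V: "R i j = V i * (D i * R i j)" for j using DV[OF that] by (simp add: algebra_simps)
    \<comment> \<open>Elimination controls the entry above the diagonal; symmetry carries this to
      the entry below it. In the last row both sides are 0.\<close>
    have "R (Suc i) i = - (m i * V i * R (Suc i) (Suc i))"
    proof (cases "Suc i < n")
      case True
      have "D i * R i (Suc i) = - (m i * R (Suc i) (Suc i))"
        using elim[of i "Suc i"] True by (simp add: eq_neg_iff_add_eq_0)
      with V[of "Suc i"] show ?thesis by (simp add: R_sym[of "Suc i" i])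
    qed (simp add: R_out)
    moreover have "D i * R i i = 1 - m i * R (Suc i) i"
      using elim[of i i] that by (simp add: algebra_simps)
    ultimately show ?thesis
      using V[of i] by (simp add: c_def power2_eq_square algebra_simps)
  qed
  define u where "u i = - fps_deriv (D i)" for i
  have u0: "u 0 = 1" by (simp add: u_def D0)
  have uSuc: "u (Suc i) = 1 + c i * u i" if "Suc i < n" for i
  proof -
    have "fps_deriv (V i) = - fps_deriv (D i) * V i ^ 2"
      unfolding V_def using that by (intro fps_inverse_deriv Dnz) auto
    then show ?thesis using that
      by (simp add: u_def DSuc V_def[symmetric] c_def m_def power2_eq_square algebra_simps)
  qed
  \<comment> \<open>The induction expands \<open>R k k * u k\<close> once by the recurrence for
    \<open>u\<close> and once by \<open>R_diag\<close>. The boundary term vanishes at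
    \<open>k = n\<close>, where \<open>R n n = 0\<close>.\<close>
  have "(\<Sum>i<k. R i i) = (\<Sum>i<k. u i * V i) + (if k = 0 then 0 else c (k - 1) * u (k - 1) * R k k)"
    if "k \<le> n" for k
    using that
  proof (induction k)
    case (Suc k)
    have "R k k * u k = R k k * (1 + (if k = 0 then 0 else c (k - 1) * u (k - 1)))"
      using Suc.prems u0 uSuc[of "k - 1"] by (cases k) auto
    moreover have "R k k * u k = (V k + c k * R (Suc k) (Suc k)) * u k"
      using R_diag[of k] Suc.prems by simp
    ultimately show ?case using Suc by (auto simp: algebra_simps)
  qed simp
  from this[of n] show ?thesis by (auto simp: R_out R_def[symmetric] u_def V_def)
qed


section \<open>Exponential generating functions\<close>

definition egf :: "(nat \<Rightarrow> 'a :: field_char_0) \<Rightarrow> 'a fps" where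
  "egf a = Abs_fps (\<lambda>n. a n / fact n)"

lemma egf_nth [simp]: "fps_nth (egf a) n = a n / fact n"
  by (simp add: egf_def)

lemma egf_mult_nth:
  fixes a b :: "nat \<Rightarrow> 'a :: field_char_0"
  assumes "a 0 = 0"
  shows "fps_nth (egf a * egf b) n = (\<Sum>k = 1..n. of_nat (n choose k) * a k * b (n - k)) / fact n"
proof -
  have "fps_nth (egf a * egf b) n = (\<Sum>k = 0..n. of_nat (n choose k) * a k * b (n - k) / fact n)"
    unfolding fps_mult_nth by (intro sum.cong refl) (simp add: binomial_fact)
  also have "\<dots> = (\<Sum>k = 1..n. of_nat (n choose k) * a k * b (n - k) / fact n)"
    using assms by (simp add: sum.atLeast_Suc_atMost)
  finally show ?thesis by (simp add: sum_divide_distrib)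
qed

lemma fps_deriv_egf: "fps_deriv (egf a) = egf (\<lambda>n. a (Suc n))"
proof (rule fps_ext)
  show "fps_nth (fps_deriv (egf a)) n = fps_nth (egf (\<lambda>n. a (Suc n))) n" for n
    using of_nat_neq_0[of n, where ?'a = 'a]
    by (simp add: fps_deriv_nth divide_simps flip: of_nat_Suc)
qed

text \<open>The product of the two series is a binomial sum up to \<open>k = p\<close>, but the
  recurrence stops at \<open>p - 2\<close>. The term \<open>k = p\<close> is 0 since
  \<open>b 0 = 0\<close>. The term \<open>k = p - 1\<close> is
  \<open>p * a (p - 1) * (f * a 1 + r)\<close>: its \<open>f\<close> part cancels the extra summand
  of the recurrence, and its \<open>r\<close> part is balanced by subtracting \<open>r\<close> times
  \<open>x\<close> from the series of \<open>b\<close>.\<close>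

lemma egf_pivot_recurrence:
  fixes a b :: "nat \<Rightarrow> 'a :: field_char_0"
  assumes [simp]: "a 0 = 0" "b 0 = 0" and b1: "b 1 = f * a 1 + r"
    and b: "\<And>p. p \<ge> 2 \<Longrightarrow> b p = f * (a p + of_nat p * a 1 * a (p - 1))
              + (\<Sum>k = 1..p - 2. of_nat (p choose k) * a k * b (p - k))"
  shows "(1 - egf a) * (egf b - fps_const r * fps_X) = fps_const f * egf a"
proof (rule fps_ext)
  fix p
  show "fps_nth ((1 - egf a) * (egf b - fps_const r * fps_X)) p = fps_nth (fps_const f * egf a) p"
  proof -
    consider "p = 0" | "p = 1" | m where "p = Suc (Suc m)"
      by (metis One_nat_def not0_implies_Suc)
    then show ?thesis
    proof cases
      case 3
      have "(\<Sum>k = 1..p. of_nat (p choose k) * a k * b (p - k))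
          = (\<Sum>k = 1..m. of_nat (p choose k) * a k * b (p - k)) + of_nat p * a (Suc m) * b 1"
        using 3 binomial_Suc_n[of "Suc m"] by (simp del: binomial_Suc_Suc)
      moreover have "b p = f * (a p + of_nat p * a 1 * a (Suc m))
          + (\<Sum>k = 1..m. of_nat (p choose k) * a k * b (p - k))"
        using b[of p] 3 by simp
      ultimately have "b p - (\<Sum>k = 1..p. of_nat (p choose k) * a k * b (p - k))
          + r * of_nat p * a (Suc m) = f * a p"
        by (simp add: b1 algebra_simps del: One_nat_def)
      moreover have "fps_nth ((1 - egf a) * (egf b - fps_const r * fps_X)) p
          = (b p - (\<Sum>k = 1..p. of_nat (p choose k) * a k * b (p - k))) / fact p
            + r * (a (Suc m) / fact (Suc m))"
        using 3 egf_mult_nth[of a b p]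
        by (simp add: algebra_simps diff_divide_distrib fps_mult_right_const_nth del: fact_Suc)
      moreover have "r * (a (Suc m) / fact (Suc m)) = r * of_nat p * a (Suc m) / fact p"
        using 3 of_nat_neq_0[of "Suc m", where ?'a = 'a] fact_Suc[of "Suc m", where ?'a = 'a]
        by (simp del: of_nat_Suc fact_Suc)
      ultimately show ?thesis by (simp add: add_divide_distrib[symmetric])
    qed (use b1 in \<open>auto simp: fps_mult_nth\<close>)
  qed
qed

section \<open>The Gram matrix and the trace formula\<close>

lemma bidiag_gram_index:
  fixes q e :: "nat \<Rightarrow> real"
  assumes "i < N" "j < N" "\<And>i. i \<in> {1..N} \<Longrightarrow> q i > 0" "\<And>i. i \<in> {1..N - 1} \<Longrightarrow> e i > 0"
  shows "(transpose_mat (bidiag_mat N q e) * bidiag_mat N q e) $$ (i, j) =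
     (if i = j then q (Suc i) + (if i = 0 then 0 else e i)
      else if j = Suc i then sqrt (q (Suc i) * e (Suc i))
      else if i = Suc j then sqrt (q (Suc j) * e (Suc j)) else 0)"
proof -
  define b where "b = (\<lambda>k l. if l = k then sqrt (q (k + 1))
     else if l = k + 1 then sqrt (e (k + 1)) else 0)"
  have B: "bidiag_mat N q e = mat N N (\<lambda>(i, j). b i j)"
    by (simp add: bidiag_mat_def b_def)
  have "(transpose_mat (bidiag_mat N q e) * bidiag_mat N q e) $$ (i, j) = (\<Sum>k<N. b k i * b k j)"
    using assms(1,2) by (simp add: B scalar_prod_def lessThan_atLeast0)
  \<comment> \<open>Column \<open>i\<close> of the bidiagonal matrix is supported in rows
    \<open>i - 1\<close> and \<open>i\<close>, which coincide for \<open>i = 0\<close>.\<close>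
  also have "\<dots> = (\<Sum>k\<in>{i - 1, i}. b k i * b k j)"
    using assms(1) by (intro sum.mono_neutral_right) (auto simp: b_def)
  also have "\<dots> = (if i = 0 then 0 else b (i - 1) i * b (i - 1) j) + b i i * b i j"
    by auto
  moreover have "e i > 0" if "i \<noteq> 0"
    using that assms(1) by (intro assms(4)) auto
  ultimately show ?thesis
    using assms(1,2) assms(3)[of "Suc i"]
    by (cases i) (auto simp: b_def real_sqrt_mult)
qed

theorem theorem2p4:
  fixes N :: nat and q e F :: "nat \<Rightarrow> real" and h H :: "nat \<Rightarrow> nat \<Rightarrow> real" and B :: "real mat"
  assumes "N \<ge> 1"
    and "\<And>i. i \<in> {1..N} \<Longrightarrow> q i > 0"
    and "\<And>i. i \<in> {1..N - 1} \<Longrightarrow> e i > 0"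
    and "B = bidiag_mat N q e"
    and "\<And>i. i \<in> {2..N} \<Longrightarrow> F i = e (i - 1) / q i"
    and "h 1 1 = 1 / q 1"
    and "\<And>i. i \<in> {2..N} \<Longrightarrow> h i 1 = F i * h (i - 1) 1 + 1 / q i"
    and "\<And>p. p \<ge> 2 \<Longrightarrow> h 1 p = 0"
    and "\<And>i p. i \<in> {2..N} \<Longrightarrow> p \<ge> 2 \<Longrightarrow>
           h i p = F i * (h (i - 1) p + real p * h (i - 1) 1 * h (i - 1) (p - 1))
                   + (\<Sum>k = 1..p - 2. real (p choose k) * h (i - 1) k * h i (p - k))"
    and "\<And>i. i \<in> {1..N} \<Longrightarrow> H i 1 = h i 1"
    and "\<And>i p. i \<in> {1..N} \<Longrightarrow> p \<ge> 2 \<Longrightarrow>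
           H i p = h i p + (\<Sum>k = 1..p - 1. real ((p - 1) choose k) * h i k * H i (p - k))"
  shows "\<forall>p\<ge>1. mat_trace (mat_neg_power (transpose_mat B * B) p)
                = 1 / fact (p - 1) * (\<Sum>i = 1..N. H i p)"
proof -
  note q_pos = assms(2) and e_pos = assms(3)
  define A where "A = transpose_mat B * B"
  have B: "B \<in> carrier_mat N N" by (simp add: assms(4) bidiag_mat_def)
  then have A: "A \<in> carrier_mat N N" by (simp add: A_def)
  obtain C where C: "mat_inverse A = Some C" "C \<in> carrier_mat N N" "A * C = 1\<^sub>m N"
    using bidiag_gram_inverse[of N q e] q_pos unfolding A_def assms(4) by metis
  have A_index: "A $$ (i, j) =
      (if i = j then q (Suc i) + (if i = 0 then 0 else e i)
       else if j = Suc i then sqrt (q (Suc i) * e (Suc i))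
       else if i = Suc j then sqrt (q (Suc j) * e (Suc j)) else 0)" if "i < N" "j < N" for i j
    unfolding A_def assms(4) using that q_pos e_pos by (rule bidiag_gram_index)
  have A_sym: "transpose_mat A = A"
    using B transpose_mult[of "transpose_mat B" N N B N] by (simp add: A_def)
  \<comment> \<open>The hypotheses leave \<open>h i 0\<close> unspecified. Setting it to 0 gives
    \<open>g i\<close> zero constant term, so \<open>1 - g i\<close> is invertible.\<close>
  define a where "a i p = (if p = 0 then 0 else h i p)" for i p
  define g where "g i = egf (a i)" for i
  \<comment> \<open>The shift matches the resolvent, whose coefficient \<open>n\<close> belongs to
    the power \<open>p = n + 1\<close>, and accounts for the factorial of
    \<open>p - 1\<close>.\<close>
  define G where "G i = egf (\<lambda>n. H i (Suc n))" for i
  define D where "D i = fps_const (q (Suc i)) * (1 - g (Suc i))" for i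
  have D_nz: "fps_nth (D i) 0 \<noteq> 0" if "i < N" for i
    using that q_pos[of "Suc i"] by (simp add: D_def g_def a_def)
  have D_inverse: "D i * inverse (D i) = 1" if "i < N" for i
    by (rule inverse_mult_eq_1'[OF D_nz[OF that]])
  have key: "(1 - g i) * (g (Suc i) - fps_const (1 / q (Suc i)) * fps_X)
      = fps_const (F (Suc i)) * g i" if "i \<in> {1..<N}" for i
    unfolding g_def
  proof (rule egf_pivot_recurrence)
    fix p :: nat
    assume p: "p \<ge> 2"
    have "(\<Sum>k = 1..p - 2. real (p choose k) * h i k * h (Suc i) (p - k))
        = (\<Sum>k = 1..p - 2. real (p choose k) * a i k * a (Suc i) (p - k))"
      by (intro sum.cong) (auto simp: a_def)
    then show "a (Suc i) p = F (Suc i) * (a i p + real p * a i 1 * a i (p - 1))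
        + (\<Sum>k = 1..p - 2. real (p choose k) * a i k * a (Suc i) (p - k))"
      using p that assms(9)[of "Suc i" p] by (simp add: a_def)
  qed (use that assms(7)[of "Suc i"] in \<open>auto simp: a_def\<close>)
  have "(\<Sum>i<N. resolvent_fps C i i) = (\<Sum>i<N. - fps_deriv (D i) * inverse (D i))"
  proof (rule trace_resolvent_tridiagonal[OF A C(2,3) A_sym _ _ _ D_nz])
    \<comment> \<open>Only the coefficient for \<open>p = 1\<close> survives, so the first pivot is
      \<open>q 1 - x\<close>.\<close>
    have "g 1 = fps_const (1 / q 1) * fps_X"
    proof (rule fps_ext)
      show "fps_nth (g 1) p = fps_nth (fps_const (1 / q 1) * fps_X) p" for p
        using assms(6) assms(8)[of p] by (cases "p = 1") (auto simp: g_def a_def)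
    qed
    then have "D 0 = fps_const (q 1) - fps_const (q 1) * fps_const (1 / q 1) * fps_X"
      by (simp add: D_def algebra_simps)
    then show "D 0 = fps_const (A $$ (0, 0)) - fps_X"
      using q_pos[of 1] \<open>N \<ge> 1\<close> by (simp add: A_index)
  next
    fix i
    assume i: "Suc i < N"
    define V where "V = inverse (D i)"
    define Q where "Q = fps_const (q (Suc (Suc i)))"
    define Q' where "Q' = fps_const (q (Suc i))"
    define E where "E = fps_const (e (Suc i))"
    have DV: "Q' * (1 - g (Suc i)) * V = 1"
      using D_inverse[of i] i by (simp add: V_def D_def Q'_def)
    have Qr: "Q * fps_const (1 / q (Suc (Suc i))) = 1" and QF: "Q * fps_const (F (Suc (Suc i))) = E"
      using q_pos[of "Suc (Suc i)"] assms(5)[of "Suc (Suc i)"] i by (simp_all add: Q_def E_def)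
    define w where "w = g (Suc (Suc i)) - fps_const (1 / q (Suc (Suc i))) * fps_X"
    have "Q * w = Q * g (Suc (Suc i)) - (Q * fps_const (1 / q (Suc (Suc i)))) * fps_X"
      by (simp only: w_def right_diff_distrib mult.assoc)
    then have "(1 - g (Suc i)) * (Q * g (Suc (Suc i)) - fps_X) = (1 - g (Suc i)) * (Q * w)"
      by (simp only: Qr mult_1_left)
    also have "\<dots> = Q * ((1 - g (Suc i)) * w)" by (rule mult.left_commute)
    also have "(1 - g (Suc i)) * w = fps_const (F (Suc (Suc i))) * g (Suc i)"
      unfolding w_def using i by (intro key) auto
    also have "Q * \<dots> = E * g (Suc i)"
      by (simp only: QF mult.assoc[symmetric])
    \<comment> \<open>By \<open>DV\<close>, the factor \<open>Q' * V\<close> is the inverse of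
      \<open>1 - g (Suc i)\<close>. Since \<open>g / (1 - g) = 1 / (1 - g) - 1\<close>, the
      right-hand side becomes \<open>E * Q' * V - E\<close>; here \<open>E * Q'\<close> is the
      squared off-diagonal entry and \<open>E\<close> its share of the next diagonal entry.\<close>
    finally have "Q' * V * ((1 - g (Suc i)) * (Q * g (Suc (Suc i)) - fps_X)) = Q' * V * (E * g (Suc i))"
      by (rule arg_cong)
    then have "(Q' * (1 - g (Suc i)) * V) * (Q * g (Suc (Suc i)) - fps_X)
        = E * Q' * V - E * (Q' * (1 - g (Suc i)) * V)"
      by (simp add: algebra_simps)
    then have Qg: "Q * g (Suc (Suc i)) = fps_X + E * Q' * V - E"
      unfolding DV by (simp add: algebra_simps)
    have "D (Suc i) = Q - Q * g (Suc (Suc i))"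
      by (simp add: D_def Q_def algebra_simps)
    moreover have "fps_const (A $$ (Suc i, Suc i)) = Q + E"
      using i by (simp add: A_index Q_def E_def)
    moreover have "q (Suc i) > 0" "e (Suc i) > 0"
      using i by (auto intro!: q_pos e_pos)
    then have "fps_const ((A $$ (i, Suc i))\<^sup>2) = Q' * E"
      using i by (simp add: A_index Q'_def E_def)
    ultimately show "D (Suc i) = fps_const (A $$ (Suc i, Suc i)) - fps_X
        - fps_const ((A $$ (i, Suc i))\<^sup>2) * inverse (D i)"
      unfolding V_def[symmetric] by (simp add: Qg algebra_simps)
  qed (auto simp: A_index)
  also have "\<dots> = (\<Sum>i<N. G (Suc i))"
  proof (rule sum.cong)
    fix i
    assume "i \<in> {..<N}"
    then have i: "i < N" by simp
    \<comment> \<open>The recurrence for \<open>H\<close> in generating-function form: the shifted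
      sequence of \<open>h\<close> gives the derivative of \<open>g\<close>, the binomial sum gives
      the product.\<close>
    have "G (Suc i) = fps_deriv (g (Suc i)) + g (Suc i) * G (Suc i)"
    proof (rule fps_ext)
      fix n
      have H_Suc: "H (Suc i) (Suc n) = h (Suc i) (Suc n)
          + (\<Sum>k = 1..n. real (n choose k) * a (Suc i) k * H (Suc i) (Suc (n - k)))"
      proof (cases "n = 0")
        case True
        with assms(10)[of "Suc i"] i show ?thesis by simp
      next
        case False
        have "(\<Sum>k = 1..n. real (n choose k) * h (Suc i) k * H (Suc i) (Suc n - k))
            = (\<Sum>k = 1..n. real (n choose k) * a (Suc i) k * H (Suc i) (Suc (n - k)))"
          by (intro sum.cong) (auto simp: a_def Suc_diff_le)
        with False assms(11)[of "Suc i" "Suc n"] i show ?thesis by simp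
      qed
      have "fps_nth (fps_deriv (g (Suc i)) + g (Suc i) * G (Suc i)) n = H (Suc i) (Suc n) / fact n"
        unfolding H_Suc
        by (simp add: G_def g_def fps_deriv_egf egf_mult_nth a_def add_divide_distrib
              del: fps_deriv_nth)
      then show "fps_nth (G (Suc i)) n = fps_nth (fps_deriv (g (Suc i)) + g (Suc i) * G (Suc i)) n"
        by (simp add: G_def)
    qed
    then have "fps_deriv (g (Suc i)) = (1 - g (Suc i)) * G (Suc i)"
      by (simp add: algebra_simps)
    then have "- fps_deriv (D i) = D i * G (Suc i)"
      by (simp add: D_def mult.assoc)
    then have "- fps_deriv (D i) * inverse (D i) = (D i * inverse (D i)) * G (Suc i)"
      by (simp only: mult_ac)
    then show "- fps_deriv (D i) * inverse (D i) = G (Suc i)"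
      using D_inverse[OF i] by simp
  qed simp
  finally have trace: "(\<Sum>i<N. resolvent_fps C i i) = (\<Sum>i<N. G (Suc i))" .
  show ?thesis
  proof (intro allI impI)
    fix p :: nat
    assume "p \<ge> 1"
    then obtain n where n: "p = Suc n" by (cases p) auto
    have "mat_trace (mat_neg_power A p) = fps_nth (\<Sum>i<N. resolvent_fps C i i) n"
      using C by (simp add: mat_trace_def mat_neg_power_def n fps_sum_nth resolvent_fps_def)
    also have "\<dots> = (\<Sum>i<N. H (Suc i) p) / fact n"
      by (simp add: trace fps_sum_nth G_def n sum_divide_distrib)
    also have "(\<Sum>i<N. H (Suc i) p) = (\<Sum>i = 1..N. H i p)"
      by (simp add: sum.atLeast1_atMost_eq)
    finally show "mat_trace (mat_neg_power (transpose_mat B * B) p)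
        = 1 / fact (p - 1) * (\<Sum>i = 1..N. H i p)"
      by (simp add: A_def n)
  qed
qed

end
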